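(* Let $d \ge 3$. Let $X = (X_1,\ldots,X_d)^\top$ be a random vector such that: (i) $X_1,\ldots,X_d$ are independent; (ii) $X_d \sim \mathcal{N}(\mu,\sigma^2)$ with $\mu \ne 0$ and $\sigma > 0$; (iii) for $i = 1,\ldots,d-1$, $X_i \sim \mathrm{Gamma}(\alpha_i,\lambda_i)$ with $\alpha_i > 0$ and $\lambda_i > 0$; (iv) whenever $\sum_{i \in I} \alpha_i = \sum_{j \in J} \alpha_j$ for subsets $I$ and $J$ of $\{1,\ldots,d-1\}$, then $I = J$. Let $\epsilon$ be a real random variable independent of $X$, let $\beta_0 = (\beta_{01},\ldots,\beta_{0d})^\top \in \mathbb{R}^d$, and let $Y$ be a real random variable with $Y \overset{d}{=} \beta_0^\top X + \epsilon$. Put $\mathcal{B}_0 = \{\beta \in \mathbb{R}^d : Y \overset{d}{=} \beta^\top X + \epsilon\}$. Then $\mathcal{B}_0 = \{\beta_0\}$.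
   Context: $\overset{d}{=}$ denotes equality in distribution. $\mathrm{Gamma}(\alpha,\lambda)$ is the Gamma distribution with shape $\alpha$ and rate $\lambda$, i.e. with moment-generating function $t \mapsto \lambda^\alpha/(\lambda - t)^\alpha$ for $t < \lambda$. *)

theory Defs
  imports "HOL-Probability.Probability"
begin

text \<open>Shape \<open>a\<close> and rate \<open>l\<close>.\<close>

definition gamma_density :: "real \<Rightarrow> real \<Rightarrow> real \<Rightarrow> real" where
  "gamma_density a l x =
     (if x \<le> 0 then 0 else l powr a / Gamma a * x powr (a - 1) * exp (- (l * x)))"

lemma borel_measurable_gamma_density [measurable]:
  "gamma_density a l \<in> borel_measurable borel"
  unfolding gamma_density_def by measurable

text \<open>The moment-generating function; \<open>t = 0\<close> shows that the density has total mass 1.\<close>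

lemma nn_integral_exp_gamma_density:
  fixes a l t :: real
  assumes a: "a > 0" and l: "l > 0" and t: "t < l"
  shows "(\<integral>\<^sup>+x. ennreal (exp (t * x) * gamma_density a l x) \<partial>lborel)
           = ennreal (l powr a / (l - t) powr a)"
proof -
  define c where "c = l - t"
  have c: "c > 0" using t by (simp add: c_def)
  have Ga: "Gamma a > 0" using a by (rule Gamma_real_pos)
  have "ennreal (Gamma a) = (\<integral>\<^sup>+x. ennreal (indicator {0..} x * x powr (a - 1) / exp x) \<partial>lborel)"
    by (rule Gamma_conv_nn_integral_real[OF a])
  also have "\<dots> = \<bar>c\<bar> * (\<integral>\<^sup>+x. ennreal (indicator {0..} (0 + c * x) * (0 + c * x) powr (a - 1)
                          / exp (0 + c * x)) \<partial>lborel)"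
    using c by (intro nn_integral_real_affine) auto
  finally have G: "ennreal (Gamma a) = ennreal c * (\<integral>\<^sup>+x. ennreal (indicator {0..} (c * x)
                      * (c * x) powr (a - 1) / exp (c * x)) \<partial>lborel)"
    using c by simp
  let ?K = "l powr a / (Gamma a * c powr a)"
  have pt: "exp (t * x) * gamma_density a l x
      = ?K * (c * (indicator {0..} (c * x) * (c * x) powr (a - 1) / exp (c * x)))" for x
  proof (cases "x > 0")
    case True
    have 1: "exp (t * x) * exp (- (l * x)) = inverse (exp (c * x))"
      by (simp add: c_def algebra_simps flip: exp_add exp_minus)
    have 2: "c powr a = c * c powr (a - 1)"
      using c by (simp add: powr_diff)
    have cc: "c powr (a - 1) > 0" using c by simp
    have "exp (t * x) * gamma_density a l x
        = l powr a / Gamma a * x powr (a - 1) * (exp (t * x) * exp (- (l * x)))"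
      using True by (simp add: gamma_density_def)
    also have "\<dots> = l powr a / Gamma a * x powr (a - 1) * inverse (exp (c * x))"
      by (simp only: 1)
    also have "\<dots> = ?K * (c * ((c * x) powr (a - 1) / exp (c * x)))"
      using c cc True unfolding 2 by (simp add: powr_mult divide_simps)
    finally show ?thesis using c True by simp
  next
    case False
    then show ?thesis using c by (auto simp: gamma_density_def indicator_def zero_le_mult_iff)
  qed
  have "(\<integral>\<^sup>+x. ennreal (exp (t * x) * gamma_density a l x) \<partial>lborel)
      = (\<integral>\<^sup>+x. ennreal ?K * (ennreal c * ennreal (indicator {0..} (c * x)
            * (c * x) powr (a - 1) / exp (c * x))) \<partial>lborel)"
    unfolding pt using c Ga by (intro nn_integral_cong) (subst ennreal_mult', simp, subst ennreal_mult', auto)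
  also have "\<dots> = ennreal ?K * ennreal (Gamma a)"
    unfolding G by (simp add: nn_integral_cmult)
  also have "\<dots> = ennreal (l powr a / c powr a)"
    using Ga by (simp flip: ennreal_mult')
  finally show ?thesis by (simp add: c_def)
qed

definition eq_in_distr :: "'a measure \<Rightarrow> ('a \<Rightarrow> real) \<Rightarrow> 'b measure \<Rightarrow> ('b \<Rightarrow> real) \<Rightarrow> bool" where
  "eq_in_distr M U N V \<longleftrightarrow> distr M borel U = distr N borel V"

text \<open>
  Independence of two random variables whose value spaces may have different types,
  which \<^const>\<open>prob_space.indep_var\<close> does not allow. The two families of events are the
  sigma-algebras generated by \<open>U\<close> and \<open>V\<close>.
\<close>

definition indep_rvs ::
    "'a measure \<Rightarrow> 'b measure \<Rightarrow> ('a \<Rightarrow> 'b) \<Rightarrow> 'c measure \<Rightarrow> ('a \<Rightarrow> 'c) \<Rightarrow> bool" where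
  "indep_rvs M S U T V \<longleftrightarrow>
     U \<in> measurable M S \<and> V \<in> measurable M T \<and>
     prob_space.indep_set M {U -` A \<inter> space M | A. A \<in> sets S} {V -` B \<inter> space M | B. B \<in> sets T}"

lemma (in prob_space) indep_rvs_iff_indep_var:
  "indep_rvs M S U T V \<longleftrightarrow> indep_var S U T V"
proof -
  have *: "sigma_sets (space M) {f -` A \<inter> space M | A. A \<in> sets R} = {f -` A \<inter> space M | A. A \<in> sets R}"
    if "f \<in> measurable M R" for f :: "'a \<Rightarrow> 'b" and R
    using sets_vimage_algebra2[of f "space M" R] measurable_space[OF that]
      sets.sigma_sets_eq[of "vimage_algebra (space M) f R"] by auto
  show ?thesis
    unfolding indep_rvs_def indep_var_eq by (auto simp: *)
qed

end

theory Submission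
  imports Defs
begin

text \<open>
  The characteristic function of \<open>\<epsilon>\<close> does not vanish near \<open>0\<close>, so it cancels there, and the
  characteristic functions of \<open>\<beta>\<^sup>TX\<close> and \<open>\<beta>\<^sub>0\<^sup>TX\<close> agree near \<open>0\<close>. With \<open>b\<^sub>i = \<beta>\<^sub>i / \<lambda>\<^sub>i\<close>, the
  logarithmic derivative of the former is
  \<open>\<Sum>\<^sub>i \<i> \<alpha>\<^sub>i b\<^sub>i / (1 - \<i> b\<^sub>i t) + \<i> \<mu> \<beta>\<^sub>d - \<sigma>\<^sup>2 \<beta>\<^sub>d\<^sup>2 t\<close>.
  Uniqueness of partial fractions shows that for every \<open>v \<noteq> 0\<close> the total weight \<open>\<alpha>\<close> of the indices
  with \<open>b\<^sub>i = v\<close> is the same for \<open>\<beta>\<close> and \<open>\<beta>\<^sub>0\<close>; since subset sums of \<open>\<alpha>\<close> are distinct, these index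
  sets coincide. Hence \<open>\<beta>\<close> and \<open>\<beta>\<^sub>0\<close> agree on the Gamma coordinates, and comparing the values at
  \<open>t = 0\<close> leaves \<open>\<mu> \<beta>\<^sub>d = \<mu> \<beta>\<^sub>0\<^sub>d\<close>.
\<close>

section \<open>Moments and characteristic function of the Gamma distribution\<close>

lemma power_mult_gamma_density:
  assumes "a > 0" "l > 0"
  shows "x ^ n * gamma_density a l x = pochhammer a n / l ^ n * gamma_density (a + n) l x"
proof (cases "x > 0")
  case True
  have *: "a \<notin> \<int>\<^sub>\<le>\<^sub>0" using assms by (auto elim!: nonpos_Ints_cases)
  have G: "Gamma (a + m) \<noteq> 0" for m :: nat
    using Gamma_real_pos[of "a + m"] assms by fastforce
  have "x powr (a + n - 1) = x powr (a - 1) * x ^ n"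
    using True by (simp add: powr_add powr_diff powr_realpow)
  moreover have "l powr (a + n) = l powr a * l ^ n"
    using assms by (simp add: powr_add powr_realpow)
  ultimately show ?thesis using True assms
    using G[of 0] G[of n] by (simp add: gamma_density_def pochhammer_Gamma[OF *] field_simps)
qed (simp add: gamma_density_def)

lemma gamma_density_nonneg: "a > 0 \<Longrightarrow> 0 \<le> gamma_density a l x"
  using Gamma_real_pos[of a] by (auto simp: gamma_density_def)

lemma has_bochner_integral_gamma_density:
  assumes "a > 0" "l > 0"
  shows "has_bochner_integral lborel (gamma_density a l) 1"
proof (rule has_bochner_integral_nn_integral)
  show "AE x in lborel. 0 \<le> gamma_density a l x"
    using assms by (simp add: gamma_density_nonneg)
  show "(\<integral>\<^sup>+ x. ennreal (gamma_density a l x) \<partial>lborel) = ennreal 1"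
    using nn_integral_exp_gamma_density[of a l 0] assms by simp
qed auto

text \<open>Multiplying by \<open>x ^ n\<close> raises the shape from \<open>a\<close> to
  \<open>a + n\<close> up to a constant factor. The shifted density has mass 1, so that factor is
  the moment.\<close>

lemma has_bochner_integral_gamma_density_moment:
  assumes "a > 0" "l > 0"
  shows "has_bochner_integral lborel (\<lambda>x. gamma_density a l x * x ^ n) (pochhammer a n / l ^ n)"
proof -
  have "gamma_density a l x * x ^ n = pochhammer a n / l ^ n * gamma_density (a + n) l x" for x
    using power_mult_gamma_density[OF assms, of x n] by (simp add: mult.commute)
  then show ?thesis
    using has_bochner_integral_mult_right[OF has_bochner_integral_gamma_density[of "a + n" l], of "pochhammer a n / l ^ n"] assms
    by simp
qed

text \<open>Matches the terms of the moment series with those of the binomial series of (1 - w) to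
  the power -z. It is used with w = it/l for the series itself and with w = |t|/l for its
  majorant.\<close>

lemma gbinomial_uminus_pochhammer:
  "(- z gchoose n) * (- w) ^ n = pochhammer z n * w ^ n / fact n"
  for z w :: "'a :: field_char_0"
  by (simp add: gbinomial_pochhammer power_minus[of w])

text \<open>
  Expanding the exponential and integrating termwise turns the moments into a binomial series. Its
  radius of convergence restricts \<open>t\<close>, which is harmless since only small \<open>t\<close> matter.
\<close>

lemma char_gamma:
  assumes a: "a > 0" and l: "l > 0" and t: "\<bar>t\<bar> < l"
  shows "char (density lborel (gamma_density a l)) t = (1 - \<i> * (t / l)) powr (- a)"
proof -
  let ?g = "gamma_density a l"
  define f where "f n x = complex_of_real (?g x * x ^ n) * ((\<i> * t) ^ n / fact n)" for n x
  have f: "has_bochner_integral lborel (f n) (of_real (pochhammer a n / l ^ n) * ((\<i> * t) ^ n / fact n))" for n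
    unfolding f_def
    by (intro has_bochner_integral_mult_left has_bochner_integral_of_real
        has_bochner_integral_gamma_density_moment a l)
  \<comment> \<open>The density vanishes for x <= 0, so \<open>x ^ n\<close> needs no absolute value
    and the norms integrate to moments again.\<close>
  have norm_f: "norm (f n x) = ?g x * x ^ n * (\<bar>t\<bar> ^ n / fact n)" for n x
  proof (cases "x > 0")
    case True
    then show ?thesis using gamma_density_nonneg[OF a, of l x]
      by (simp add: f_def norm_mult norm_divide norm_power)
  qed (simp add: f_def gamma_density_def)
  have sums_f: "(\<lambda>n. f n x) sums (of_real (?g x) * iexp (t * x))" for x
    using sums_mult[OF exp_converges[of "\<i> * complex_of_real (t * x)"], of "of_real (?g x)"]
    by (simp add: f_def scaleR_conv_of_real power_mult_distrib field_simps)
  have "(\<lambda>n. integral\<^sup>L lborel (f n)) sums (\<integral>x. (\<Sum>n. f n x) \<partial>lborel)"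
  proof (rule sums_integral)
    show "integrable lborel (f n)" for n using f by (rule has_bochner_integral_iff[THEN iffD1, THEN conjunct1])
    show "AE x in lborel. summable (\<lambda>n. norm (f n x))"
    proof (rule AE_I2)
      fix x
      have "summable (\<lambda>n. ?g x * (x * \<bar>t\<bar>) ^ n / fact n)"
        using summable_mult[OF summable_exp[of "x * \<bar>t\<bar>"], of "?g x"] by (simp add: field_simps)
      then show "summable (\<lambda>n. norm (f n x))" by (simp add: norm_f power_mult_distrib mult_ac)
    qed
    \<comment> \<open>The integrated norms form the binomial series of (1 - |t|/l) to the power -a,
      which converges since |t| < l. This justifies exchanging sum and integral.\<close>
    have "has_bochner_integral lborel (\<lambda>x. norm (f n x)) (pochhammer a n / l ^ n * (\<bar>t\<bar> ^ n / fact n))" for n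
      unfolding norm_f by (intro has_bochner_integral_mult_left has_bochner_integral_gamma_density_moment a l)
    then have "(\<lambda>n. \<integral>x. norm (f n x) \<partial>lborel) = (\<lambda>n. (- a gchoose n) * (- (\<bar>t\<bar> / l)) ^ n)"
      by (auto simp: has_bochner_integral_iff gbinomial_uminus_pochhammer power_divide)
    moreover have "summable \<dots>"
      using gen_binomial_real[of "- (\<bar>t\<bar> / l)" "- a"] t l by (auto simp: sums_iff)
    ultimately show "summable (\<lambda>n. \<integral>x. norm (f n x) \<partial>lborel)" by simp
  qed
  moreover have "(\<integral>x. (\<Sum>n. f n x) \<partial>lborel) = char (density lborel ?g) t"
    unfolding char_def
    by (subst integral_density) (auto simp: sums_unique[OF sums_f, symmetric] scaleR_conv_of_real gamma_density_nonneg a)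
  moreover have "integral\<^sup>L lborel (f n) = (- complex_of_real a gchoose n) * (- (\<i> * (t / l))) ^ n" for n
    using f[of n]
    by (simp add: has_bochner_integral_iff gbinomial_uminus_pochhammer power_divide power_mult_distrib
        pochhammer_of_real)
  ultimately have "(\<lambda>n. (- complex_of_real a gchoose n) * (- (\<i> * (t / l))) ^ n) sums char (density lborel ?g) t"
    by simp
  moreover have "(\<lambda>n. (- complex_of_real a gchoose n) * (- (\<i> * (t / l))) ^ n) sums (1 + - (\<i> * (t / l))) powr (- of_real a)"
    using t l by (intro gen_binomial_complex) (simp add: norm_mult norm_divide)
  ultimately show ?thesis
    using sums_unique2 by fastforce
qed

section \<open>Characteristic functions of scaled and normal variables\<close>

lemma (in prob_space) char_distr_cmult:
  assumes [measurable]: "random_variable borel X"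
  shows "char (distr M borel (\<lambda>\<omega>. c * X \<omega>)) t = char (distr M borel X) (c * t)"
  by (simp add: char_def integral_distr mult_ac)

lemma distributed_lborel_distr_borel:
  assumes "distributed M lborel X f"
  shows "distr M borel X = density lborel f"
proof -
  have "distr M borel X = distr M lborel X" by (rule distr_cong) auto
  then show ?thesis using distributed_distr_eq_density[OF assms] by simp
qed

lemma (in prob_space) char_normal:
  assumes X: "distributed M lborel X (normal_density \<mu> \<sigma>)" and \<sigma>: "\<sigma> > 0"
  shows "char (distr M borel X) t = exp (\<i> * \<mu> * t - \<sigma>\<^sup>2 * t\<^sup>2 / 2)"
proof -
  define Z where "Z \<omega> = (X \<omega> - \<mu>) / \<sigma>" for \<omega>
  have Z: "distributed M lborel Z std_normal_density"
    unfolding Z_def using X by (rule normal_standard_normal_convert[OF \<sigma>, THEN iffD1])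
  have [measurable]: "random_variable borel X" "random_variable borel Z"
    using distributed_measurable[OF X] distributed_measurable[OF Z] by simp_all
  have "char (distr M borel X) t = (CLINT \<omega>|M. iexp (t * \<mu>) * iexp ((\<sigma> * t) * Z \<omega>))"
    using \<sigma> by (simp add: char_def integral_distr Z_def field_simps flip: exp_add)
  also have "\<dots> = iexp (t * \<mu>) * char (distr M borel Z) (\<sigma> * t)"
    by (simp add: char_def integral_distr)
  also have "\<dots> = iexp (t * \<mu>) * exp (of_real (- ((\<sigma> * t)\<^sup>2) / 2))"
    by (simp add: distributed_lborel_distr_borel[OF Z] char_std_normal_distribution exp_of_real del: of_real_minus)
  finally show ?thesis
    by (simp add: mult_ac power_mult_distrib flip: exp_add)
qed

section \<open>Uniqueness of partial fractions\<close>

lemma one_minus_ii_times_real_nonzero: "1 - \<i> * (of_real x * of_real y) \<noteq> 0"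
  by (simp add: complex_eq_iff)

lemma partial_fraction_coeff_zero:
  fixes V S :: "real set" and c :: "real \<Rightarrow> complex"
  assumes V: "finite V" "0 \<notin> V" and S: "infinite S"
    and eq: "\<And>t. t \<in> S \<Longrightarrow> (\<Sum>v\<in>V. c v / (1 - \<i> * (of_real v * of_real t))) + A + B * of_real t = 0"
    and v: "v \<in> V"
  shows "c v = 0"
proof -
  \<comment> \<open>Clearing denominators gives a polynomial with infinitely many roots, evaluated at the pole \<open>1 / (\<i> v)\<close>.\<close>
  define Q where "Q w = [:1, - (\<i> * of_real w):]" for w
  have poly_Q: "poly (Q w) x = 1 - \<i> * (of_real w * x)" for w x by (simp add: Q_def)
  define P where "P = (\<Sum>v\<in>V. [:c v:] * (\<Prod>w\<in>V - {v}. Q w)) + [:A, B:] * (\<Prod>w\<in>V. Q w)"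
  have "poly P (of_real t) = 0" if "t \<in> S" for t
  proof -
    let ?q = "\<lambda>w. 1 - \<i> * (complex_of_real w * of_real t)"
    have "(\<Prod>w\<in>V - {u}. ?q w) = (\<Prod>w\<in>V. ?q w) / ?q u" if "u \<in> V" for u
      using that V by (simp add: prod.remove one_minus_ii_times_real_nonzero)
    then have "poly P (of_real t) = (\<Prod>w\<in>V. ?q w) * ((\<Sum>v\<in>V. c v / ?q v) + A + B * of_real t)"
      by (simp add: P_def poly_sum poly_prod poly_Q distrib_left sum_distrib_left algebra_simps)
    then show ?thesis using eq[OF that] by simp
  qed
  then have "of_real ` S \<subseteq> {x. poly P x = 0}" by auto
  moreover have "infinite (complex_of_real ` S)"
    using S by (simp add: finite_image_iff inj_on_def)
  ultimately have "P = 0" using poly_roots_finite finite_subset by blast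
  define x where "x = 1 / (\<i> * complex_of_real v)"
  have v0: "v \<noteq> 0" using v V by auto
  have Qx: "poly (Q w) x = 1 - of_real (w / v)" for w
    using v0 by (simp add: poly_Q x_def)
  have Qx0: "poly (Q w) x = 0 \<longleftrightarrow> w = v" for w
    unfolding Qx using v0 by (auto simp flip: of_real_divide)
  \<comment> \<open>Only \<open>Q v\<close> vanishes at \<open>x\<close>. Every product containing
    it drops out, including the one multiplying \<open>[:A, B:]\<close>, and only the term of
    \<open>v\<close> survives.\<close>
  have "(\<Sum>u\<in>V. c u * (\<Prod>w\<in>V - {u}. poly (Q w) x)) = (\<Sum>u\<in>V. if u = v then c v * (\<Prod>w\<in>V - {v}. poly (Q w) x) else 0)"
    using V v Qx0 by (intro sum.cong) (auto intro!: prod_zero bexI[of _ v])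
  moreover have prod0: "(\<Prod>w\<in>V. poly (Q w) x) = 0" using V v Qx0 by (intro prod_zero) auto
  ultimately have "poly P x = c v * (\<Prod>w\<in>V - {v}. poly (Q w) x)"
    using V v by (simp add: P_def poly_sum poly_prod prod0 del: prod_zero_iff)
  moreover have "(\<Prod>w\<in>V - {v}. poly (Q w) x) \<noteq> 0" using V Qx0 by simp
  ultimately show ?thesis using \<open>P = 0\<close> by simp
qed

text \<open>Indices with the same value of \<open>b\<close> will share a pole, so their weights are
  collected. The later choice is z = 0, the value that produces no pole.\<close>

lemma sum_weighted_by_value:
  fixes a h :: "_ \<Rightarrow> 'c :: comm_ring_1"
  assumes "finite K" "finite V" "b ` K \<subseteq> insert z V" "z \<notin> V" "h z = 0"
  shows "(\<Sum>k\<in>K. a k * h (b k)) = (\<Sum>v\<in>V. (\<Sum>k | k \<in> K \<and> b k = v. a k) * h v)"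
proof -
  have "(\<Sum>k\<in>K. a k * h (b k)) = (\<Sum>v\<in>insert z V. \<Sum>k | k \<in> K \<and> b k = v. a k * h (b k))"
    using assms by (intro sum.group[symmetric]) auto
  also have "\<dots> = (\<Sum>v\<in>insert z V. (\<Sum>k | k \<in> K \<and> b k = v. a k) * h v)"
    by (intro sum.cong) (auto simp: sum_distrib_right)
  finally show ?thesis using assms by simp
qed

text \<open>A term with value u has its only pole at 1/(iu). Over a common set of poles the
  difference of the two sums is a single partial fraction expansion, whose coefficients must all
  vanish.\<close>

lemma pole_weights_eq:
  fixes a b c :: "'k \<Rightarrow> real" and A B :: complex
  assumes K: "finite K" and S: "infinite S" and v: "v \<noteq> 0"
    and eq: "\<And>t. t \<in> S \<Longrightarrow>
      (\<Sum>k\<in>K. of_real (a k) * (\<i> * b k / (1 - \<i> * (of_real (b k) * of_real t))))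
      - (\<Sum>k\<in>K. of_real (a k) * (\<i> * c k / (1 - \<i> * (of_real (c k) * of_real t))))
      + A + B * of_real t = 0"
  shows "(\<Sum>k | k \<in> K \<and> b k = v. a k) = (\<Sum>k | k \<in> K \<and> c k = v. a k)"
proof -
  \<comment> \<open>\<open>v\<close> is inserted so that a value attained by neither family is
    covered too.\<close>
  define V where "V = insert v (b ` K \<union> c ` K) - {0}"
  define w where "w f u = (\<Sum>k | k \<in> K \<and> f k = u. complex_of_real (a k))" for f :: "'k \<Rightarrow> real" and u :: real
  have V: "finite V" "0 \<notin> V" "v \<in> V" using K v by (auto simp: V_def)
  have "(w b v - w c v) * (\<i> * v) = 0"
  proof (rule partial_fraction_coeff_zero[OF V(1,2) S _ V(3), where c = "\<lambda>u. (w b u - w c u) * (\<i> * of_real u)"])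
    fix t assume "t \<in> S"
    define h where "h u = \<i> * complex_of_real u / (1 - \<i> * (of_real u * of_real t))" for u
    have group: "(\<Sum>k\<in>K. of_real (a k) * h (f k)) = (\<Sum>u\<in>V. w f u * h u)" if "f \<in> {b, c}" for f
      unfolding w_def using that K V
      by (intro sum_weighted_by_value[where z = 0]) (auto simp: V_def h_def)
    have "(\<Sum>u\<in>V. (w b u - w c u) * h u) + A + B * of_real t = 0"
      using eq[OF \<open>t \<in> S\<close>, folded h_def] group[of b] group[of c]
      by (simp add: left_diff_distrib sum_subtractf)
    then show "(\<Sum>u\<in>V. (w b u - w c u) * (\<i> * of_real u) / (1 - \<i> * (of_real u * of_real t))) + A + B * of_real t = 0"
      by (simp only: h_def times_divide_eq_right)
  qed
  then have "w b v = w c v" using v by simp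
  then show ?thesis by (simp add: w_def flip: of_real_sum)
qed

section \<open>The exponent of the characteristic function and its derivative\<close>

definition log_char ::
    "'k set \<Rightarrow> 'k \<Rightarrow> ('k \<Rightarrow> real) \<Rightarrow> ('k \<Rightarrow> real) \<Rightarrow> real \<Rightarrow> real \<Rightarrow> ('k \<Rightarrow> real) \<Rightarrow> complex \<Rightarrow> complex" where
  "log_char K m a r \<mu> \<sigma> \<beta> z =
     (\<Sum>k\<in>K. - of_real (a k) * Ln (1 - \<i> * (of_real (\<beta> k / r k) * z)))
     + \<i> * of_real (\<mu> * \<beta> m) * z - of_real ((\<sigma> * \<beta> m)\<^sup>2 / 2) * z\<^sup>2"

text \<open>The argument of \<open>log_char\<close> is complex so that the complex differentiation
  rules for \<open>Ln\<close> apply, although only real points matter.\<close>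

lemma has_field_derivative_log_char:
  "(log_char K m a r \<mu> \<sigma> \<beta> has_field_derivative
     (\<Sum>k\<in>K. of_real (a k) * (\<i> * (\<beta> k / r k) / (1 - \<i> * (of_real (\<beta> k / r k) * of_real t))))
     + \<i> * of_real (\<mu> * \<beta> m) - of_real ((\<sigma> * \<beta> m)\<^sup>2) * of_real t) (at (of_real t))"
proof -
  define b where "b k = \<beta> k / r k" for k
  \<comment> \<open>For real t this number has real part 1, hence lies off the branch cut of
    \<open>Ln\<close>.\<close>
  have *: "1 - \<i> * (of_real (b k) * of_real t) \<notin> \<real>\<^sub>\<le>\<^sub>0" for k
    by (simp add: complex_nonpos_Reals_iff flip: of_real_mult)
  have "((\<lambda>z. - of_real (a k) * Ln (1 - \<i> * (of_real (b k) * z))) has_field_derivative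
      of_real (a k) * (\<i> * b k / (1 - \<i> * (of_real (b k) * of_real t)))) (at (of_real t))" for k
    by (rule derivative_eq_intros * refl)+ (simp add: divide_inverse)
  then have sum: "((\<lambda>z. \<Sum>k\<in>K. - of_real (a k) * Ln (1 - \<i> * (of_real (b k) * z))) has_field_derivative
      (\<Sum>k\<in>K. of_real (a k) * (\<i> * b k / (1 - \<i> * (of_real (b k) * of_real t))))) (at (of_real t))"
    by (rule DERIV_sum)
  have "((\<lambda>z. (\<Sum>k\<in>K. - of_real (a k) * Ln (1 - \<i> * (of_real (b k) * z)))
        + \<i> * of_real (\<mu> * \<beta> m) * z - of_real ((\<sigma> * \<beta> m)\<^sup>2 / 2) * z\<^sup>2) has_field_derivative
      (\<Sum>k\<in>K. of_real (a k) * (\<i> * b k / (1 - \<i> * (of_real (b k) * of_real t))))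
        + \<i> * of_real (\<mu> * \<beta> m) - of_real ((\<sigma> * \<beta> m)\<^sup>2) * of_real t) (at (of_real t))"
    by (rule sum derivative_eq_intros refl)+ simp
  then show ?thesis unfolding log_char_def[abs_def] b_def .
qed

text \<open>Independence gives a product of characteristic functions. The bound on
  \<open>\<beta> k * t\<close> keeps each Gamma factor within the range of
  \<open>char_gamma\<close>.\<close>

lemma (in prob_space) char_gamma_normal_combination:
  assumes K: "finite K" "m \<notin> K"
    and indep: "indep_vars (\<lambda>_. borel) X (insert m K)"
    and normal: "distributed M lborel (X m) (normal_density \<mu> \<sigma>)" "\<sigma> > 0"
    and gamma: "\<And>k. k \<in> K \<Longrightarrow> distributed M lborel (X k) (gamma_density (a k) (r k))"
      "\<And>k. k \<in> K \<Longrightarrow> a k > 0" "\<And>k. k \<in> K \<Longrightarrow> r k > 0"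
    and t: "\<And>k. k \<in> K \<Longrightarrow> \<bar>\<beta> k * t\<bar> < r k"
  shows "char (distr M borel (\<lambda>\<omega>. \<Sum>k\<in>insert m K. \<beta> k * X k \<omega>)) t =
    exp (log_char K m a r \<mu> \<sigma> \<beta> (of_real t))"
proof -
  have rv: "random_variable borel (X k)" if "k \<in> insert m K" for k
    using indep that by (auto simp: indep_vars_def)
  have "indep_vars (\<lambda>_. borel) (\<lambda>k \<omega>. \<beta> k * X k \<omega>) (insert m K)"
    by (rule indep_vars_compose2[OF indep]) auto
  then have "char (distr M borel (\<lambda>\<omega>. \<Sum>k\<in>insert m K. \<beta> k * X k \<omega>)) t =
      (\<Prod>k\<in>insert m K. char (distr M borel (X k)) (\<beta> k * t))"
    by (simp only: char_distr_sum) (intro prod.cong refl char_distr_cmult rv)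
  also have "\<dots> = char (distr M borel (X m)) (\<beta> m * t) * (\<Prod>k\<in>K. char (distr M borel (X k)) (\<beta> k * t))"
    using K by simp
  also have "(\<Prod>k\<in>K. char (distr M borel (X k)) (\<beta> k * t)) =
      (\<Prod>k\<in>K. exp (- of_real (a k) * Ln (1 - \<i> * (of_real (\<beta> k / r k) * of_real t))))"
  proof (rule prod.cong[OF refl])
    fix k assume k: "k \<in> K"
    have "char (distr M borel (X k)) (\<beta> k * t) = (1 - \<i> * (\<beta> k * t / r k)) powr (- a k)"
      using char_gamma[of "a k" "r k" "\<beta> k * t"] gamma t k by (simp add: distributed_lborel_distr_borel[OF gamma(1)])
    also have "1 - \<i> * (\<beta> k * t / r k) = 1 - \<i> * (of_real (\<beta> k / r k) * of_real t)"
      by simp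
    finally show "char (distr M borel (X k)) (\<beta> k * t) = exp (- of_real (a k) * Ln (1 - \<i> * (of_real (\<beta> k / r k) * of_real t)))"
      by (simp only: powr_def one_minus_ii_times_real_nonzero if_False of_real_minus)
  qed
  also have "\<dots> = exp (\<Sum>k\<in>K. - of_real (a k) * Ln (1 - \<i> * (of_real (\<beta> k / r k) * of_real t)))"
    using K by (simp only: exp_sum)
  finally show ?thesis
    unfolding char_normal[OF normal]
    by (simp add: log_char_def mult_ac power_mult_distrib add_ac diff_add_eq add_diff_eq flip: exp_add)
qed

lemma log_char_eq_imp_coeffs_eq:
  assumes K: "finite K" and S: "open S" "0 \<in> S"
    and r: "\<And>k. k \<in> K \<Longrightarrow> r k \<noteq> 0" and \<mu>: "\<mu> \<noteq> 0"
    and a: "\<And>I J. I \<subseteq> K \<Longrightarrow> J \<subseteq> K \<Longrightarrow> sum a I = sum a J \<Longrightarrow> I = J"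
    and eq: "\<And>t :: real. t \<in> S \<Longrightarrow>
      exp (log_char K m a r \<mu> \<sigma> \<beta> (of_real t)) = exp (log_char K m a r \<mu> \<sigma> \<gamma> (of_real t))"
    and k: "k \<in> insert m K"
  shows "\<beta> k = \<gamma> k"
proof -
  define F where "F \<delta> t = (\<Sum>k\<in>K. of_real (a k) * (\<i> * (\<delta> k / r k) / (1 - \<i> * (of_real (\<delta> k / r k) * of_real t))))"
    for \<delta> and t :: real
  have deriv: "F \<beta> t - F \<gamma> t + \<i> * of_real (\<mu> * (\<beta> m - \<gamma> m))
      + of_real ((\<sigma> * \<gamma> m)\<^sup>2 - (\<sigma> * \<beta> m)\<^sup>2) * of_real t = 0" (is "?D = 0") if t: "t \<in> S" for t
  proof -
    \<comment> \<open>Differentiating \<open>exp (G t) = 1\<close> gives \<open>G' = 0\<close> without discussing branches of the logarithm.\<close>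
    let ?G = "\<lambda>z. log_char K m a r \<mu> \<sigma> \<beta> z - log_char K m a r \<mu> \<sigma> \<gamma> z"
    have "((\<lambda>z. exp (?G z)) has_field_derivative exp (?G (of_real t)) * ?D) (at (of_real t))"
      by (rule derivative_eq_intros has_field_derivative_log_char refl)+
        (simp add: F_def algebra_simps)
    \<comment> \<open>The identity is known for real arguments only, so the derivative is restricted
      to the real line before it is compared with that of the constant 1.\<close>
    then have "((\<lambda>x. exp (?G (of_real x))) has_vector_derivative exp (?G (of_real t)) * ?D) (at t)"
      by (rule has_vector_derivative_real_field)
    then have "((\<lambda>x. 1) has_vector_derivative exp (?G (of_real t)) * ?D) (at t)"
      by (rule has_vector_derivative_transform_within_open[OF _ S(1) t]) (simp add: exp_diff eq)
    then have "exp (?G (of_real t)) * ?D = 0"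
      by (rule vector_derivative_unique_at[OF _ has_vector_derivative_const])
    then show "?D = 0" by simp
  qed
  have "infinite S" using S finite_imp_not_open by blast
  \<comment> \<open>\<open>pole_weights_eq\<close> makes the two weight sums equal, and the distinct
    subset sums then force equal index sets.\<close>
  have "{k \<in> K. \<beta> k / r k = v} = {k \<in> K. \<gamma> k / r k = v}" if "v \<noteq> 0" for v
    by (rule a) (auto intro!: pole_weights_eq[OF K \<open>infinite S\<close> that deriv[unfolded F_def]])
  then have same_value: "\<beta> k / r k = v \<longleftrightarrow> \<gamma> k / r k = v" if "v \<noteq> 0" "k \<in> K" for v k
    using that by blast
  have K_eq: "\<beta> k = \<gamma> k" if "k \<in> K" for k
  proof -
    \<comment> \<open>If either quotient is nonzero, \<open>same_value\<close> at that value gives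
      equality; otherwise both are 0.\<close>
    have "\<beta> k / r k = \<gamma> k / r k"
      using same_value[OF _ that] by metis
    then show ?thesis using r[OF that] by simp
  qed
  \<comment> \<open>At t = 0 the variance term disappears; it would fix \<open>\<beta> m\<close>
    only up to sign. The mean term determines it because \<open>\<mu>\<close> is nonzero.\<close>
  then have "F \<beta> 0 = F \<gamma> 0" by (simp add: F_def)
  then have "\<beta> m = \<gamma> m" using deriv[OF S(2)] \<mu> by simp
  then show ?thesis using K_eq k by blast
qed

section \<open>Cancelling the noise\<close>

lemma (in prob_space) indep_set_mono:
  "indep_set A B \<Longrightarrow> A' \<subseteq> A \<Longrightarrow> B' \<subseteq> B \<Longrightarrow> indep_set A' B'"
  unfolding indep_sets2_eq by blast

text \<open>Events of \<open>f \<circ> V\<close> are events of \<open>V\<close>. This passes from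
  the vector \<open>X\<close> to a real linear combination, for which \<open>indep_var\<close> is
  available.\<close>

lemma (in prob_space) indep_rvs_compose:
  assumes indep: "indep_rvs M S U T V" and f: "f \<in> measurable T R"
  shows "indep_rvs M S U R (f \<circ> V)"
proof -
  have V: "V \<in> measurable M T" using indep by (simp add: indep_rvs_def)
  have *: "(f \<circ> V) -` B \<inter> space M = V -` (f -` B \<inter> space T) \<inter> space M" for B
    using measurable_space[OF V] by auto
  have "{(f \<circ> V) -` B \<inter> space M |B. B \<in> sets R} \<subseteq> {V -` B \<inter> space M |B. B \<in> sets T}"
  proof clarify
    fix B assume "B \<in> sets R"
    with * measurable_sets[OF f] show "\<exists>A. (f \<circ> V) -` B \<inter> space M = V -` A \<inter> space M \<and> A \<in> sets T"
      by meson
  qed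
  from indep_set_mono[OF _ order_refl this] show ?thesis
    using indep measurable_comp[OF V f] unfolding indep_rvs_def by iprover
qed

text \<open>A characteristic function is continuous and equals 1 at 0.\<close>

lemma (in prob_space) eventually_char_nonzero:
  assumes [measurable]: "random_variable borel X"
  shows "eventually (\<lambda>t. char (distr M borel X) t \<noteq> 0) (nhds 0)"
proof -
  interpret D: real_distribution "distr M borel X" by (rule real_distribution_distr) simp
  have "(char (distr M borel X) \<longlongrightarrow> char (distr M borel X) 0) (nhds 0)"
    using D.isCont_char[of 0] by (simp add: isCont_def tendsto_at_iff_tendsto_nhds)
  then show ?thesis by (rule tendsto_imp_eventually_ne) (simp add: D.char_zero)
qed

theorem theorem5:
  fixes d :: nat
    and M :: "'a measure" and X :: "'a \<Rightarrow> nat \<Rightarrow> real" and \<epsilon> :: "'a \<Rightarrow> real"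
    and N :: "'b measure" and Y :: "'b \<Rightarrow> real"
    and \<mu> \<sigma> :: real and \<alpha> rate :: "nat \<Rightarrow> real" and \<beta>\<^sub>0 :: "nat \<Rightarrow> real"
  assumes "d \<ge> 3"
    and "prob_space M"
    and "X \<in> measurable M (\<Pi>\<^sub>M i\<in>{1..d}. borel)"
    and "prob_space.indep_vars M (\<lambda>i. borel) (\<lambda>i \<omega>. X \<omega> i) {1..d}"
    and "\<mu> \<noteq> 0" and "\<sigma> > 0"
    and "distributed M lborel (\<lambda>\<omega>. X \<omega> d) (normal_density \<mu> \<sigma>)"
    and "\<And>i. i \<in> {1..d-1} \<Longrightarrow> \<alpha> i > 0 \<and> rate i > 0"
    and "\<And>i. i \<in> {1..d-1} \<Longrightarrow>
           distributed M lborel (\<lambda>\<omega>. X \<omega> i) (gamma_density (\<alpha> i) (rate i))"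
    and "\<And>I J. I \<subseteq> {1..d-1} \<Longrightarrow> J \<subseteq> {1..d-1} \<Longrightarrow>
           (\<Sum>i\<in>I. \<alpha> i) = (\<Sum>j\<in>J. \<alpha> j) \<Longrightarrow> I = J"
    and "indep_rvs M borel \<epsilon> (\<Pi>\<^sub>M i\<in>{1..d}. borel) X"
    and "\<beta>\<^sub>0 \<in> {1..d} \<rightarrow>\<^sub>E UNIV"
    and "prob_space N"
    and "Y \<in> borel_measurable N"
    and "eq_in_distr N Y M (\<lambda>\<omega>. (\<Sum>i\<in>{1..d}. \<beta>\<^sub>0 i * X \<omega> i) + \<epsilon> \<omega>)"
  shows "{\<beta> \<in> {1..d} \<rightarrow>\<^sub>E UNIV.
            eq_in_distr N Y M (\<lambda>\<omega>. (\<Sum>i\<in>{1..d}. \<beta> i * X \<omega> i) + \<epsilon> \<omega>)} = {\<beta>\<^sub>0}"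
proof -
  interpret prob_space M by fact
  let ?K = "{1..d-1}"
  let ?L = "\<lambda>\<delta>. log_char ?K d \<alpha> rate \<mu> \<sigma> \<delta>"
  let ?lin = "\<lambda>\<delta> \<omega>. \<Sum>i\<in>{1..d}. \<delta> i * X \<omega> i"
  let ?small = "\<lambda>\<delta> t. \<forall>i\<in>?K. \<bar>\<delta> i * t\<bar> < rate i"
  have index: "{1..d} = insert d ?K" using assms(1) by auto
  have char_lin: "char (distr M borel (?lin \<delta>)) t = exp (?L \<delta> (of_real t))" if "?small \<delta> t" for \<delta> t
    unfolding index
  proof (rule char_gamma_normal_combination[where X = "\<lambda>i \<omega>. X \<omega> i"])
    show "indep_vars (\<lambda>_. borel) (\<lambda>i \<omega>. X \<omega> i) (insert d ?K)"
      using assms(4) by (simp only: index)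
  qed (use assms(1,6,7,8,9) that in auto)
  have indep: "indep_var borel \<epsilon> borel (?lin \<delta>)" for \<delta>
    using indep_rvs_compose[OF assms(11), of "\<lambda>x. \<Sum>i\<in>{1..d}. \<delta> i * x i" borel]
    by (simp add: indep_rvs_iff_indep_var comp_def)
  have char_Y: "char (distr N borel Y) t = char (distr M borel (?lin \<delta>)) t * char (distr M borel \<epsilon>) t"
    if "eq_in_distr N Y M (\<lambda>\<omega>. ?lin \<delta> \<omega> + \<epsilon> \<omega>)" for \<delta> t
    using char_distr_add[OF indep[of \<delta>], of t] that by (simp add: eq_in_distr_def add.commute mult.commute)
  have small: "eventually (?small \<delta>) (nhds 0)" for \<delta>
  proof (intro eventually_ball_finite ballI)
    fix i assume "i \<in> ?K"
    have "((\<lambda>t. \<bar>\<delta> i * t\<bar>) \<longlongrightarrow> \<bar>\<delta> i * 0\<bar>) (nhds 0)" by (intro tendsto_intros filterlim_ident)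
    then show "eventually (\<lambda>t. \<bar>\<delta> i * t\<bar> < rate i) (nhds 0)"
      using assms(8)[OF \<open>i \<in> ?K\<close>] by (intro order_tendstoD(2)) auto
  qed simp
  have "random_variable borel \<epsilon>" using assms(11) by (simp add: indep_rvs_def)
  note char_\<epsilon> = eventually_char_nonzero[OF this]
  have "\<beta> = \<beta>\<^sub>0"
    if \<beta>: "\<beta> \<in> {1..d} \<rightarrow>\<^sub>E UNIV" and Y: "eq_in_distr N Y M (\<lambda>\<omega>. ?lin \<beta> \<omega> + \<epsilon> \<omega>)" for \<beta>
  proof -
    \<comment> \<open>Close to 0 the factor of \<open>\<epsilon>\<close> can be divided out and both
      exponential formulas are valid.\<close>
    from char_\<epsilon> small[of \<beta>] small[of \<beta>\<^sub>0]
    have "eventually (\<lambda>t. exp (?L \<beta> (of_real t)) = exp (?L \<beta>\<^sub>0 (of_real t))) (nhds 0)"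
    proof eventually_elim
      case (elim t)
      have "char (distr M borel (?lin \<beta>)) t = char (distr M borel (?lin \<beta>\<^sub>0)) t"
        using char_Y[OF Y, of t] char_Y[OF assms(15), of t] elim(1) by simp
      then show ?case unfolding char_lin[OF elim(2)] char_lin[OF elim(3)] .
    qed
    then obtain S where S: "open S" "0 \<in> S"
      "\<And>t. t \<in> S \<Longrightarrow> exp (?L \<beta> (of_real t)) = exp (?L \<beta>\<^sub>0 (of_real t))"
      unfolding eventually_nhds by auto
    have "\<beta> i = \<beta>\<^sub>0 i" if "i \<in> {1..d}" for i
      using assms(8) that unfolding index
      by (intro log_char_eq_imp_coeffs_eq[OF _ S(1,2) _ assms(5) assms(10) S(3)]) force+
    \<comment> \<open>Both functions are \<open>undefined\<close> outside \<open>{1..d}\<close>, so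
      agreement on the coordinates suffices.\<close>
    then show ?thesis using \<beta> assms(12) by (intro PiE_ext)
  qed
  then show ?thesis using assms(12,15) by blast
qed

end
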